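(* Let $p\in\mathbb{N}$ and $f\in A_p$. Then $f\in R(G)$ if and only if $f$ may be written as $f=g^{-1}h$, where $g,h\in H$ are germs of finite even order $2s$ (for some $s\in\mathbb{N}$), $g^2=h^2$, $s$ divides $p$, and $p/s$ is odd.
   Context: $G$ denotes the group (under composition) of biholomorphic germs at $0$ in one complex variable: germs of functions $f$ holomorphic near $0$ with $f(0)=0$ and $f'(0)\neq 0$. $H=\{f\in G: f'(0)=\exp(i\pi q)\text{ for some } q\in\mathbb{Q}\}$. $G_1=\{f\in G: f'(0)=1\}$, and for $p\in\mathbb{N}$, $G_p=\{f\in G_1: f^{(k)}(0)=0 \text{ for } 2\le k\le p\}$ and $A_p=G_p\setminus G_{p+1}$. $R(G)$ is the set of $f\in G$ that are reversible in $G$, i.e. for which some $g\in G$ satisfies $g^{-1}\circ f\circ g=f^{-1}$. *)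

theory Defs
  imports "HOL-Complex_Analysis.Complex_Analysis"
begin

text \<open>Germs at 0 are represented by functions complex \<Rightarrow> complex; two functions
  represent the same germ iff they agree on a neighbourhood of 0.\<close>

definition germ_eq :: "(complex \<Rightarrow> complex) \<Rightarrow> (complex \<Rightarrow> complex) \<Rightarrow> bool" (infix "\<approx>\<^sub>0" 50)
  where "f \<approx>\<^sub>0 g \<longleftrightarrow> (\<forall>\<^sub>F z in nhds 0. f z = g z)"

definition in_G :: "(complex \<Rightarrow> complex) \<Rightarrow> bool"
  where "in_G f \<longleftrightarrow> (\<exists>r>0. f holomorphic_on ball 0 r) \<and> f 0 = 0 \<and> deriv f 0 \<noteq> 0"

definition in_H :: "(complex \<Rightarrow> complex) \<Rightarrow> bool"
  where "in_H f \<longleftrightarrow> in_G f \<and> (\<exists>q\<in>\<rat>. deriv f 0 = exp (\<i> * complex_of_real pi * complex_of_real q))"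

definition in_Gp :: "nat \<Rightarrow> (complex \<Rightarrow> complex) \<Rightarrow> bool"
  where "in_Gp p f \<longleftrightarrow> in_G f \<and> deriv f 0 = 1 \<and>
            (\<forall>k. 2 \<le> k \<and> k \<le> p \<longrightarrow> (deriv ^^ k) f 0 = 0)"

definition in_Ap :: "nat \<Rightarrow> (complex \<Rightarrow> complex) \<Rightarrow> bool"
  where "in_Ap p f \<longleftrightarrow> in_Gp p f \<and> \<not> in_Gp (Suc p) f"

definition germ_inverse :: "(complex \<Rightarrow> complex) \<Rightarrow> (complex \<Rightarrow> complex) \<Rightarrow> bool"
  where "germ_inverse g ginv \<longleftrightarrow> in_G ginv \<and> (ginv \<circ> g) \<approx>\<^sub>0 id \<and> (g \<circ> ginv) \<approx>\<^sub>0 id"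

definition reversible :: "(complex \<Rightarrow> complex) \<Rightarrow> bool"
  where "reversible f \<longleftrightarrow> in_G f \<and>
     (\<exists>g ginv finv. in_G g \<and> germ_inverse g ginv \<and> germ_inverse f finv \<and>
        (ginv \<circ> f \<circ> g) \<approx>\<^sub>0 finv)"

definition germ_order :: "(complex \<Rightarrow> complex) \<Rightarrow> nat \<Rightarrow> bool"
  where "germ_order g n \<longleftrightarrow> 0 < n \<and> (g ^^ n) \<approx>\<^sub>0 id \<and>
            (\<forall>m. 0 < m \<and> m < n \<longrightarrow> \<not> (g ^^ m) \<approx>\<^sub>0 id)"

end

theory Submission
  imports Defs
begin

text \<open>If g reverses f, i.e. f g f = g, comparing coefficients of z^(p+1) shows that the multiplier
  c = g'(0) satisfies c^p = -1, so c has order 2s with s | p and p/s odd. The power k = g^(2s) is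
  tangent to the identity and commutes with f and with g. If k were not the identity, commuting
  with f would force k to have order of tangency exactly p, and then commuting with g would force
  c^p = 1. Hence g has order 2s, and so does h = g f, because h^2 = g (f g f) = g^2. Conversely,
  f = g^(-1) h with g^2 = h^2 gives g f g^(-1) = h g^(-1) = f^(-1).\<close>

section \<open>Leading coefficients of compositions\<close>

text \<open>The binomial expansion truncated after its linear term. An unspecified remainder
  \<open>R\<close> suffices, since only coefficients up to degree \<open>q\<close> are read off
  later.\<close>

lemma fps_one_plus_X_power_mult_power:
  fixes B :: "'a::comm_ring_1 fps"
  shows "\<exists>R. (1 + fps_X ^ q * B) ^ i = 1 + of_nat i * (fps_X ^ q * B) + fps_X ^ (2 * q) * R"
proof (induction i)
  case 0
  show ?case by (rule exI[of _ 0]) simp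
next
  case (Suc i)
  then obtain R where R: "(1 + fps_X ^ q * B) ^ i
      = 1 + of_nat i * (fps_X ^ q * B) + fps_X ^ (2 * q) * R" by blast
  have X2: "fps_X ^ (2 * q) = (fps_X ^ q * fps_X ^ q :: 'a fps)"
    by (simp add: mult_2 power_add)
  show ?case
    \<comment> \<open>Collects the multiples of \<open>fps_X ^ (2 * q)\<close> in the product of
      \<open>1 + fps_X ^ q * B\<close> with the induction hypothesis.\<close>
    by (rule exI[of _ "R + of_nat i * B * B + fps_X ^ q * B * R"])
       (simp only: power_Suc R X2, simp add: algebra_simps)
qed

lemma fps_nth_one_plus_X_power_mult_power:
  fixes B :: "'a::comm_ring_1 fps"
  assumes "0 < q" "n \<le> q"
  shows "fps_nth ((1 + fps_X ^ q * B) ^ i) n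
    = (if n = 0 then 1 else if n = q then of_nat i * fps_nth B 0 else 0)"
proof -
  obtain R where "(1 + fps_X ^ q * B) ^ i
      = 1 + of_nat i * (fps_X ^ q * B) + fps_X ^ (2 * q) * R"
    using fps_one_plus_X_power_mult_power by blast
  moreover have "of_nat i * (fps_X ^ q * B) = fps_X ^ q * (fps_const (of_nat i) * B)"
    by (simp add: fps_of_nat mult.left_commute)
  ultimately show ?thesis
    using assms by (auto simp: fps_X_power_mult_nth)
qed

text \<open>The i-th power of the inner series is X^i (1 + X^q B)^i. In degree m + q it contributes
  1 for i = m + q and m times the leading coefficient of B for i = m, but nothing for i strictly
  between; the coefficients of C below m vanish.\<close>

lemma fps_nth_compose_tangent:
  fixes B C :: "'a::comm_ring_1 fps"
  assumes "0 < q" and C: "\<And>i. i < m \<Longrightarrow> fps_nth C i = 0"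
  shows "fps_nth (C oo (fps_X + fps_X ^ (q + 1) * B)) (m + q)
    = fps_nth C (m + q) + of_nat m * fps_nth C m * fps_nth B 0"
proof -
  let ?K = "fps_X + fps_X ^ (q + 1) * B"
  have K: "?K = fps_X * (1 + fps_X ^ q * B)"
    by (simp add: algebra_simps)
  have pow: "fps_nth (?K ^ i) (m + q) = (if i = m + q then 1
      else if i = m then of_nat m * fps_nth B 0 else 0)" if "i \<in> {m..m + q}" for i
    unfolding K power_mult_distrib
    using that \<open>0 < q\<close>
    by (auto simp: fps_X_power_mult_nth fps_nth_one_plus_X_power_mult_power)
  have "fps_nth (C oo ?K) (m + q) = (\<Sum>i=0..m + q. fps_nth C i * fps_nth (?K ^ i) (m + q))"
    by (simp add: fps_compose_nth)
  also have "\<dots> = (\<Sum>i\<in>{m..m + q}. fps_nth C i * fps_nth (?K ^ i) (m + q))"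
    by (rule sum.mono_neutral_right) (auto simp: C)
  also have "\<dots> = (\<Sum>i\<in>{m..m + q}. (if i = m + q then fps_nth C i else 0)
      + (if i = m then fps_nth C i * (of_nat m * fps_nth B 0) else 0))"
    by (rule sum.cong[OF refl], subst pow) (use \<open>0 < q\<close> in auto)
  also have "\<dots> = fps_nth C (m + q) + of_nat m * fps_nth C m * fps_nth B 0"
    by (simp add: sum.distrib algebra_simps)
  finally show ?thesis .
qed

text \<open>The perturbation becomes \<open>G ^ n * (A oo G)\<close>. Since G has no constant term,
  G^n starts in degree n, so only the constant term of \<open>A oo G\<close> reaches that
  degree.\<close>

lemma fps_nth_tangent_compose:
  fixes A G :: "'a::idom fps"
  assumes "fps_nth G 0 = 0"
  shows "fps_nth ((fps_X + fps_X ^ n * A) oo G) n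
    = fps_nth G n + fps_nth A 0 * fps_nth G 1 ^ n"
proof -
  have "(fps_X + fps_X ^ n * A) oo G = G + G ^ n * (A oo G)"
    using assms by (simp add: fps_compose_add_distrib fps_compose_mult_distrib
        fps_compose_power[symmetric])
  moreover have "fps_nth (G ^ n * (A oo G)) n = fps_nth G 1 ^ n * fps_nth A 0"
  proof -
    have "fps_nth (G ^ n * (A oo G)) n = (\<Sum>i=0..n. fps_nth (G ^ n) i * fps_nth (A oo G) (n - i))"
      by (simp add: fps_mult_nth)
    also have "\<dots> = (\<Sum>i\<in>{n}. fps_nth (G ^ n) i * fps_nth (A oo G) (n - i))"
      using startsby_zero_power_prefix[OF assms, of n]
      by (intro sum.mono_neutral_right) auto
    finally show ?thesis
      using startsby_zero_power_nth_same[OF assms, of n] by simp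
  qed
  ultimately show ?thesis by simp
qed

lemma fps_nth_compose_1:
  assumes "fps_nth G 0 = 0"
  shows "fps_nth (F oo G) 1 = fps_nth F 1 * fps_nth G 1"
  by (simp add: fps_compose_nth)

text \<open>In degree p + q + 1 the two compositions agree except for the cross term of the leading
  coefficients a and b, which is (p + 1) a b for one order and (q + 1) a b for the other.
  Characteristic zero then forces p = q.\<close>

lemma commuting_tangent_fps_order_eq:
  fixes A B :: "'a::{idom,ring_char_0} fps"
  assumes "0 < p" "0 < q" "fps_nth A 0 \<noteq> 0" "fps_nth B 0 \<noteq> 0"
    and F: "F = fps_X + fps_X ^ (p + 1) * A" and K: "K = fps_X + fps_X ^ (q + 1) * B"
    and comm: "F oo K = K oo F"
  shows "p = q"
proof -
  \<comment> \<open>Stated for arbitrary orders and series, so that it also applies with the two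
    factors exchanged.\<close>
  have key: "fps_nth ((fps_X + fps_X ^ (p + 1) * A) oo (fps_X + fps_X ^ (q + 1) * B)) (p + q + 1)
      = fps_nth A q + fps_nth B p + of_nat (p + 1) * fps_nth A 0 * fps_nth B 0"
    if "0 < p" "0 < q" for p q and A B :: "'a fps"
  proof -
    let ?K = "fps_X + fps_X ^ (q + 1) * B" and ?C = "fps_X ^ (p + 1) * A"
    have "(fps_X + ?C) oo ?K = ?K + (?C oo ?K)"
      by (simp add: fps_compose_add_distrib)
    moreover have "fps_nth (?C oo ?K) (p + 1 + q)
        = fps_nth ?C (p + 1 + q) + of_nat (p + 1) * fps_nth ?C (p + 1) * fps_nth B 0"
      by (rule fps_nth_compose_tangent) (use that in \<open>auto simp: fps_X_power_mult_nth simp del: power_Suc\<close>)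
    ultimately show ?thesis
      using that by (simp add: fps_X_power_mult_nth add.commute add.left_commute
          del: power_Suc of_nat_Suc)
  qed
  have "of_nat (p + 1) * (fps_nth A 0 * fps_nth B 0)
      = (of_nat (q + 1) * (fps_nth A 0 * fps_nth B 0) :: 'a)"
    using key[of p q A B] key[of q p B A] comm assms(1,2)
    by (auto simp: F K algebra_simps)
  then have "of_nat (p + 1) = (of_nat (q + 1) :: 'a)"
    using assms(3,4) by (simp del: of_nat_add)
  then show ?thesis
    by (simp only: of_nat_eq_iff)
qed

section \<open>Reversers of tangent series have finite order\<close>

text \<open>Let a be the leading coefficient of A and c the multiplier of G. In degree p + 1 the
  right factor F adds c a and the left one adds a c^(p+1); these must cancel.\<close>

lemma reverser_multiplier:
  fixes A G :: "'a::idom fps"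
  assumes "0 < p" "fps_nth A 0 \<noteq> 0" and F: "F = fps_X + fps_X ^ (p + 1) * A"
    and G: "fps_nth G 0 = 0" "fps_nth G 1 \<noteq> 0" and rev: "F oo G oo F = G"
  shows "fps_nth G 1 ^ p = - 1"
proof -
  have "fps_nth F 0 = 0" "fps_nth F 1 = 1"
    using \<open>0 < p\<close> by (simp_all add: F fps_X_power_mult_nth del: power_Suc)
  then have "fps_nth (F oo G) 0 = 0" "fps_nth (F oo G) 1 = fps_nth G 1"
    using G by (simp_all add: fps_nth_compose_1 del: One_nat_def)
  then have "fps_nth (F oo G oo F) (1 + p)
      = fps_nth (F oo G) (1 + p) + fps_nth G 1 * fps_nth A 0"
    unfolding F using fps_nth_compose_tangent[of p 1 "F oo G" A] \<open>0 < p\<close> by (simp add: F)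
  moreover have "fps_nth (F oo G) (p + 1)
      = fps_nth G (p + 1) + fps_nth A 0 * fps_nth G 1 ^ (p + 1)"
    unfolding F by (rule fps_nth_tangent_compose) (use G in simp)
  ultimately have "fps_nth A 0 * fps_nth G 1 * (fps_nth G 1 ^ p + 1) = 0"
    using rev by (simp add: algebra_simps)
  then show ?thesis
    using assms(2) G by (simp add: eq_neg_iff_add_eq_0)
qed

text \<open>The same two contributions as for a reverser, now on opposite sides of the equation,
  which changes the sign of the result.\<close>

lemma centralizer_multiplier:
  fixes B G :: "'a::idom fps"
  assumes "0 < q" "fps_nth B 0 \<noteq> 0" and K: "K = fps_X + fps_X ^ (q + 1) * B"
    and G: "fps_nth G 0 = 0" "fps_nth G 1 \<noteq> 0" and comm: "K oo G = G oo K"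
  shows "fps_nth G 1 ^ q = 1"
proof -
  have "fps_nth (G oo K) (1 + q) = fps_nth G (1 + q) + fps_nth G 1 * fps_nth B 0"
    unfolding K using fps_nth_compose_tangent[of q 1 G B] \<open>0 < q\<close> G by simp
  moreover have "fps_nth (K oo G) (q + 1)
      = fps_nth G (q + 1) + fps_nth B 0 * fps_nth G 1 ^ (q + 1)"
    unfolding K by (rule fps_nth_tangent_compose) (use G in simp)
  ultimately have "fps_nth B 0 * fps_nth G 1 * (fps_nth G 1 ^ q - 1) = 0"
    using comm by (simp add: algebra_simps)
  then show ?thesis
    using assms(2) G by simp
qed

lemma tangent_fps_cases:
  fixes K :: "'a::comm_ring_1 fps"
  assumes "fps_nth K 0 = 0" "fps_nth K 1 = 1"
  obtains "K = fps_X"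
  | q B where "0 < q" "fps_nth B 0 \<noteq> 0" "K = fps_X + fps_X ^ (q + 1) * B"
proof (cases "K = fps_X")
  case False
  define D where "D = K - fps_X"
  have D: "D \<noteq> 0" using False by (simp add: D_def)
  have "fps_nth D 0 = 0" "fps_nth D 1 = 0" using assms by (simp_all add: D_def)
  moreover have "fps_nth D (subdegree D) \<noteq> 0" using D by simp
  ultimately have "subdegree D \<noteq> 0" "subdegree D \<noteq> 1" by metis+
  \<comment> \<open>The order of tangency is one less than the subdegree of
    \<open>K - fps_X\<close>, which is at least 2, so the subtraction is not truncated.\<close>
  then have q: "0 < subdegree D - 1" "subdegree D - 1 + 1 = subdegree D" by simp_all
  have "D = fps_X ^ subdegree D * fps_shift (subdegree D) D"
    by (metis fps_shift_times_fps_X_power' mult.commute subdegree_decompose)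
  then have "K = fps_X + fps_X ^ (subdegree D - 1 + 1) * fps_shift (subdegree D) D"
    unfolding q(2) by (simp add: D_def)
  moreover have "fps_nth (fps_shift (subdegree D) D) 0 \<noteq> 0" using D by simp
  ultimately show ?thesis using that(2) q(1) by blast
qed (rule that)

section \<open>Iterates of a power series under composition\<close>

definition fps_comp_power :: "'a::comm_ring_1 fps \<Rightarrow> nat \<Rightarrow> 'a fps"
  where "fps_comp_power G n = ((\<lambda>H. G oo H) ^^ n) fps_X"

lemma fps_comp_power_0 [simp]: "fps_comp_power G 0 = fps_X"
  and fps_comp_power_Suc [simp]: "fps_comp_power G (Suc n) = G oo fps_comp_power G n"
  by (simp_all add: fps_comp_power_def)

lemma fps_nth_comp_power:
  assumes "fps_nth G 0 = 0"
  shows fps_nth_comp_power_0: "fps_nth (fps_comp_power G n) 0 = 0"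
    and fps_nth_comp_power_1: "fps_nth (fps_comp_power G n) 1 = fps_nth G 1 ^ n"
proof -
  show *: "fps_nth (fps_comp_power G n) 0 = 0" for n
    using assms by (cases n) simp_all
  show "fps_nth (fps_comp_power G n) 1 = fps_nth G 1 ^ n"
  proof (induction n)
    case (Suc n)
    then show ?case using fps_nth_compose_1[OF *, of G n] by simp
  qed simp
qed

lemma fps_comp_power_commute:
  fixes F G :: "'a::idom fps"
  assumes "fps_nth F 0 = 0" "fps_nth G 0 = 0" and comm: "F oo G = G oo F"
  shows "F oo fps_comp_power G n = fps_comp_power G n oo F"
proof (induction n)
  case 0
  show ?case using assms by simp
next
  case (Suc n)
  note Z = assms(1,2) fps_nth_comp_power_0[OF assms(2), of n]
  have "F oo (G oo fps_comp_power G n) = G oo (F oo fps_comp_power G n)"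
    using Z by (simp add: fps_compose_assoc comm)
  also have "\<dots> = G oo fps_comp_power G n oo F"
    using Z by (simp add: Suc fps_compose_assoc)
  finally show ?case by simp
qed

text \<open>Even iterates depend only on \<open>G oo G\<close>. This serves twice: a reverser need
  not commute with F although its square does, and two series with equal squares share their even
  iterates.\<close>

lemma fps_comp_power_double:
  fixes G :: "'a::idom fps"
  assumes "fps_nth G 0 = 0"
  shows "fps_comp_power G (2 * n) = fps_comp_power (G oo G) n"
  by (induction n) (use assms in \<open>simp_all add: fps_compose_assoc fps_nth_comp_power_0\<close>)

lemma reverser_finite_order:
  fixes A G :: "'a::{idom,ring_char_0} fps"
  assumes "0 < p" "fps_nth A 0 \<noteq> 0" and F: "F = fps_X + fps_X ^ (p + 1) * A"
    and G: "fps_nth G 0 = 0" "fps_nth G 1 \<noteq> 0" and rev: "F oo G oo F = G"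
    and s: "fps_nth G 1 ^ (2 * s) = 1"
  shows "fps_comp_power G (2 * s) = fps_X"
proof -
  let ?K = "fps_comp_power G (2 * s)"
  have F0: "fps_nth F 0 = 0" by (simp add: F)
  \<comment> \<open>The second G is replaced by FGF; regrouping FGFGF lets the first three factors
    collapse to G.\<close>
  have "F oo (G oo G) = F oo G oo (F oo G oo F)"
    using F0 G by (simp add: rev fps_compose_assoc)
  also have "\<dots> = (F oo G oo F) oo G oo F"
    using F0 G by (simp add: fps_compose_assoc)
  finally have "F oo (G oo G) = (G oo G) oo F" by (simp add: rev)
  then have FK: "F oo ?K = ?K oo F"
    using fps_comp_power_commute[of F "G oo G" s] F0 G by (simp add: fps_comp_power_double)
  have GK: "?K oo G = G oo ?K"
    using fps_comp_power_commute[of G G] G by simp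
  have "fps_nth ?K 0 = 0" "fps_nth ?K 1 = 1"
    using fps_nth_comp_power[OF G(1), of "2 * s"] s by simp_all
  then show ?thesis
  proof (cases rule: tangent_fps_cases)
    case (2 q B)
    then have "p = q"
      using commuting_tangent_fps_order_eq[OF assms(1) 2(1) assms(2) 2(2) F 2(3) FK] by simp
    moreover have "fps_nth G 1 ^ q = 1"
      by (rule centralizer_multiplier[OF 2 G GK])
    moreover have "fps_nth G 1 ^ p = - 1"
      by (rule reverser_multiplier[OF assms(1,2) F G rev])
    \<comment> \<open>With p = q, commuting with the iterate and reversing F put contradictory
      demands on the multiplier.\<close>
    ultimately have "(1::'a) = - 1" by simp
    then show ?thesis by (simp add: eq_neg_iff_add_eq_0)
  qed
qed

text \<open>The order n of c divides 2p but not p. Hence n is even, and s = n/2 divides p with odd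
  quotient, since an even quotient would make n divide p.\<close>

lemma primitive_order_of_root_of_minus_one:
  fixes c :: "'a::{idom,ring_char_0}"
  assumes "c ^ p = - 1" "0 < p"
  obtains s where "0 < s" "s dvd p" "odd (p div s)" "c ^ (2 * s) = 1"
    "\<And>m. 0 < m \<Longrightarrow> m < 2 * s \<Longrightarrow> c ^ m \<noteq> 1"
proof -
  define n where "n = (LEAST n. 0 < n \<and> c ^ n = 1)"
  have "0 < 2 * p \<and> c ^ (2 * p) = 1"
    using assms by (simp add: mult.commute[of 2] power_mult)
  then have n: "0 < n" "c ^ n = 1"
    unfolding n_def by (metis (mono_tags, lifting) LeastI)+
  have least: "c ^ m \<noteq> 1" if "0 < m" "m < n" for m
    using that not_less_Least[of m "\<lambda>n. 0 < n \<and> c ^ n = 1"] by (auto simp: n_def)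
  have dvd: "n dvd m" if "c ^ m = 1" for m
  proof -
    have "c ^ m = (c ^ n) ^ (m div n) * c ^ (m mod n)"
      by (metis mult_div_mod_eq power_add power_mult)
    then have "c ^ (m mod n) = 1" using that n by simp
    then show ?thesis using least[of "m mod n"] n by (metis dvd_eq_mod_eq_0 gr0I mod_less_divisor)
  qed
  have ndvd: "\<not> n dvd p"
  proof
    assume "n dvd p"
    then have "c ^ p = 1" using n by (auto simp: power_mult)
    then have "(1::'a) = - 1" using assms by simp
    then show False by (simp add: eq_neg_iff_add_eq_0)
  qed
  have "n dvd 2 * p"
    by (rule dvd) (use \<open>0 < 2 * p \<and> c ^ (2 * p) = 1\<close> in simp)
  have "even n"
  proof (rule ccontr)
    assume "odd n"
    \<comment> \<open>An odd n dividing 2p would already divide p.\<close>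
    then have "coprime n 2" by simp
    then show False using \<open>n dvd 2 * p\<close> ndvd by (simp add: coprime_dvd_mult_right_iff)
  qed
  then obtain s where s: "n = 2 * s" by blast
  show ?thesis
  proof (rule that[of s])
    show "s dvd p" using \<open>n dvd 2 * p\<close> by (simp add: s)
    then show "odd (p div s)" using ndvd by (auto simp: s)
  qed (use n least s in auto)
qed

section \<open>Germs and their power series\<close>

text \<open>Transfers the problem to power series: the coefficients in degrees 0 and 1 are the value
  and the derivative at 0.\<close>

lemma in_G_iff:
  "in_G f \<longleftrightarrow> (\<exists>F. f has_fps_expansion F \<and> fps_nth F 0 = 0 \<and> fps_nth F 1 \<noteq> 0)"
proof
  assume G: "in_G f"
  then obtain r where r: "r > 0" "f holomorphic_on ball 0 r" by (auto simp: in_G_def)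
  then have "f has_fps_expansion fps_expansion f 0"
    by (intro has_fps_expansion_fps_expansion[of "ball 0 r"]) auto
  moreover from this have "fps_nth (fps_expansion f 0) 0 = 0" "fps_nth (fps_expansion f 0) 1 \<noteq> 0"
    using G by (simp_all add: fps_nth_fps_expansion in_G_def)
  ultimately show "\<exists>F. f has_fps_expansion F \<and> fps_nth F 0 = 0 \<and> fps_nth F 1 \<noteq> 0" by blast
next
  assume "\<exists>F. f has_fps_expansion F \<and> fps_nth F 0 = 0 \<and> fps_nth F 1 \<noteq> 0"
  then obtain F where F: "f has_fps_expansion F" "fps_nth F 0 = 0" "fps_nth F 1 \<noteq> 0" by blast
  obtain S where S: "open S" "0 \<in> S" "f holomorphic_on S"
    using has_fps_expansion_imp_holomorphic[OF F(1)] by metis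
  then obtain r where "r > 0" "ball 0 r \<subseteq> S" by (meson open_contains_ball)
  then show "in_G f"
    using S F fps_nth_fps_expansion[OF F(1), of 0] fps_nth_fps_expansion[OF F(1), of 1]
    by (auto simp: in_G_def intro: holomorphic_on_subset)
qed

text \<open>One direction is uniqueness of the expansion; for the other, both functions agree near 0
  with the sum of the common series.\<close>

lemma germ_eq_iff_fps_eq:
  assumes "f has_fps_expansion F" "g has_fps_expansion G"
  shows "f \<approx>\<^sub>0 g \<longleftrightarrow> F = G"
proof
  assume "f \<approx>\<^sub>0 g"
  then have "g has_fps_expansion F"
    using assms(1) has_fps_expansion_cong[of f g F F] by (simp add: germ_eq_def)
  then show "F = G" using assms(2) fps_expansion_unique_complex by blast
next
  assume "F = G"
  with assms have "\<forall>\<^sub>F z in nhds 0. eval_fps F z = f z" "\<forall>\<^sub>F z in nhds 0. eval_fps F z = g z"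
    by (auto simp: has_fps_expansion_def)
  then show "f \<approx>\<^sub>0 g" unfolding germ_eq_def by eventually_elim simp
qed

lemma has_fps_expansion_id: "id has_fps_expansion fps_X"
  using has_fps_expansion_fps_X by (simp add: id_def)

lemma has_fps_expansion_funpow:
  fixes g :: "complex \<Rightarrow> complex"
  assumes "g has_fps_expansion G" "fps_nth G 0 = 0"
  shows "(g ^^ n) has_fps_expansion fps_comp_power G n"
proof (induction n)
  case (Suc n)
  then show ?case
    using has_fps_expansion_compose[OF assms(1) Suc] fps_nth_comp_power_0[OF assms(2)]
    by (simp add: o_def)
qed (simp add: has_fps_expansion_id[unfolded id_def])

lemma germ_inverse_fps:
  assumes "germ_inverse g ginv" "g has_fps_expansion G" "fps_nth G 0 = 0"
  obtains I where "ginv has_fps_expansion I" "fps_nth I 0 = 0" "I oo G = fps_X" "G oo I = fps_X"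
proof -
  obtain I where I: "ginv has_fps_expansion I" "fps_nth I 0 = 0"
    using assms(1) by (auto simp: germ_inverse_def in_G_iff)
  note ex = has_fps_expansion_compose[OF I(1) assms(2,3)]
    has_fps_expansion_compose[OF assms(2) I]
  show ?thesis
    using assms(1) germ_eq_iff_fps_eq[OF ex(1) has_fps_expansion_id]
      germ_eq_iff_fps_eq[OF ex(2) has_fps_expansion_id] that[OF I]
    by (simp add: germ_inverse_def)
qed

lemma in_Ap_fps:
  assumes "in_Ap p f" "0 < p"
  obtains A where "f has_fps_expansion (fps_X + fps_X ^ (p + 1) * A)" "fps_nth A 0 \<noteq> 0"
proof -
  obtain F where F: "f has_fps_expansion F" "fps_nth F 0 = 0"
    using assms by (auto simp: in_Ap_def in_Gp_def in_G_iff)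
  note nth = fps_nth_fps_expansion[OF F(1)]
  have F1: "fps_nth F 1 = 1" "\<And>k. 2 \<le> k \<Longrightarrow> k \<le> p \<Longrightarrow> fps_nth F k = 0"
    using assms by (simp_all add: nth in_Ap_def in_Gp_def)
  \<comment> \<open>Membership in G_(p+1) adds only the vanishing of the derivative of order p + 1,
    so that is what fails; p > 0 ensures p + 1 is at least 2.\<close>
  have Fp: "fps_nth F (p + 1) \<noteq> 0"
    using assms by (auto simp: nth in_Ap_def in_Gp_def le_Suc_eq simp del: funpow.simps fact_Suc)
  have "F = fps_X + fps_X ^ (p + 1) * fps_shift (p + 1) F"
  proof (rule fps_ext)
    fix n
    consider "n = 0" | "n = 1" | "2 \<le> n" "n \<le> p" | "p + 1 \<le> n" by linarith
    then show "fps_nth F n = fps_nth (fps_X + fps_X ^ (p + 1) * fps_shift (p + 1) F) n"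
      using F(2) F1 \<open>0 < p\<close> by cases (auto simp: fps_X_power_mult_nth simp del: power_Suc)
  qed
  then show ?thesis using that[of "fps_shift (p + 1) F"] F(1) Fp by simp
qed

lemma in_H_if_root_of_unity:
  assumes "in_G g" "deriv g 0 ^ n = 1" "0 < n"
  shows "in_H g"
proof -
  obtain j where "deriv g 0 = exp (2 * of_real pi * \<i> * of_nat j / of_nat n)"
    using assms complex_roots_unity[of n] by auto
  \<comment> \<open>The factor 2 moves into the rational exponent because \<open>in_H\<close>
    measures angles in multiples of pi.\<close>
  then have "deriv g 0 = exp (\<i> * complex_of_real pi * complex_of_real (2 * of_nat j / of_nat n))"
    by (simp add: field_simps)
  moreover have "(2 * of_nat j / of_nat n :: real) \<in> \<rat>" by simp
  ultimately show ?thesis using assms(1) unfolding in_H_def by blast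
qed

text \<open>Smaller iterates are excluded by their multipliers alone, as the m-th iterate has linear
  coefficient c^m.\<close>

lemma germ_orderI:
  assumes "g has_fps_expansion G" "fps_nth G 0 = 0" "0 < n" "fps_comp_power G n = fps_X"
    and "\<And>m. 0 < m \<Longrightarrow> m < n \<Longrightarrow> fps_nth G 1 ^ m \<noteq> 1"
  shows "germ_order g n"
proof -
  have "(g ^^ m) \<approx>\<^sub>0 id \<longleftrightarrow> fps_comp_power G m = fps_X" for m
    by (rule germ_eq_iff_fps_eq[OF has_fps_expansion_funpow[OF assms(1,2)] has_fps_expansion_id])
  moreover have "fps_comp_power G m \<noteq> fps_X" if "0 < m" "m < n" for m
    using assms(5)[OF that] fps_nth_comp_power_1[OF assms(2), of m] by auto
  ultimately show ?thesis using assms(3,4) by (simp add: germ_order_def)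
qed

section \<open>Reversibility and factorization into germs of finite even order\<close>

theorem theorem1p5:
  fixes p :: nat and f :: "complex \<Rightarrow> complex"
  assumes "1 \<le> p" and "in_Ap p f"
  shows "reversible f \<longleftrightarrow>
    (\<exists>g h ginv s. in_H g \<and> in_H h \<and> 0 < s \<and>
        germ_order g (2 * s) \<and> germ_order h (2 * s) \<and>
        (g \<circ> g) \<approx>\<^sub>0 (h \<circ> h) \<and> s dvd p \<and> odd (p div s) \<and>
        germ_inverse g ginv \<and> f \<approx>\<^sub>0 (ginv \<circ> h))"
    (is "_ \<longleftrightarrow> ?factors")
proof
  have p: "0 < p" using assms(1) by simp
  obtain A where f: "f has_fps_expansion (fps_X + fps_X ^ (p + 1) * A)" and A: "fps_nth A 0 \<noteq> 0"
    using in_Ap_fps[OF assms(2) p] .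
  define F where "F = fps_X + fps_X ^ (p + 1) * A"
  have f: "f has_fps_expansion F" and F0: "fps_nth F 0 = 0" and F1: "fps_nth F 1 = 1"
    using f p by (simp_all add: F_def fps_X_power_mult_nth del: power_Suc)
  assume "reversible f"
  then obtain g ginv finv where g: "in_G g" and gi: "germ_inverse g ginv"
    and fi: "germ_inverse f finv" and rev: "(ginv \<circ> f \<circ> g) \<approx>\<^sub>0 finv"
    by (auto simp: reversible_def)
  obtain G where G: "g has_fps_expansion G" "fps_nth G 0 = 0" "fps_nth G 1 \<noteq> 0"
    using g by (auto simp: in_G_iff)
  obtain I where I: "ginv has_fps_expansion I" "fps_nth I 0 = 0" "I oo G = fps_X" "G oo I = fps_X"
    using germ_inverse_fps[OF gi G(1,2)] .
  obtain J where J: "finv has_fps_expansion J" "fps_nth J 0 = 0" "J oo F = fps_X" "F oo J = fps_X"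
    using germ_inverse_fps[OF fi f F0] .
  have "(ginv \<circ> f \<circ> g) has_fps_expansion (I oo F oo G)"
    by (intro has_fps_expansion_compose I f G F0)
  then have IFG: "I oo F oo G = J"
    using rev J(1) by (simp add: germ_eq_iff_fps_eq)
  \<comment> \<open>Inserting \<open>G oo I\<close> turns the conjugation into FG = GJ; composing
    with F on the right then cancels J.\<close>
  have "F oo G = (G oo I) oo (F oo G)"
    using I(4) F0 by simp
  also have "\<dots> = G oo J"
    using IFG F0 G I by (metis fps_compose_assoc fps_compose_nth_0)
  finally have FGF: "F oo G oo F = G"
    using J F0 by (simp add: fps_compose_assoc[symmetric])
  obtain s where s: "0 < s" "s dvd p" "odd (p div s)" "fps_nth G 1 ^ (2 * s) = 1"
    and least: "\<And>m. 0 < m \<Longrightarrow> m < 2 * s \<Longrightarrow> fps_nth G 1 ^ m \<noteq> 1"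
    using primitive_order_of_root_of_minus_one[OF reverser_multiplier[OF p A F_def G(2,3) FGF] p]
    by metis
  \<comment> \<open>This choice is forced by f = g^(-1) h. As f is tangent to the identity, h has
    the same multiplier as g.\<close>
  define h where "h = g \<circ> f"
  define H where "H = G oo F"
  have h: "h has_fps_expansion H" and H0: "fps_nth H 0 = 0" and H1: "fps_nth H 1 = fps_nth G 1"
    using has_fps_expansion_compose[OF G(1) f F0] G F0 F1
    by (simp_all add: h_def H_def fps_nth_compose_1 del: One_nat_def)
  have HH: "H oo H = G oo G"
  proof -
    have "H oo H = G oo (F oo G oo F)"
      using F0 G by (simp add: H_def fps_compose_assoc)
    then show ?thesis by (simp add: FGF)
  qed
  have ordG: "fps_comp_power G (2 * s) = fps_X"
    by (rule reverser_finite_order[OF p A F_def G(2,3) FGF s(4)])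
  then have ordH: "fps_comp_power H (2 * s) = fps_X"
    using G H0 HH by (simp add: fps_comp_power_double)
  have "in_G h" using h H0 H1 G(3) in_G_iff by auto
  have "in_H g" "in_H h"
    using fps_nth_fps_expansion[OF G(1), of 1] fps_nth_fps_expansion[OF h, of 1] H1 s
    by (auto intro!: in_H_if_root_of_unity[of _ "2 * s"] g \<open>in_G h\<close>)
  moreover have "germ_order g (2 * s)"
    by (rule germ_orderI[OF G(1,2)]) (use s ordG least in auto)
  moreover have "germ_order h (2 * s)"
    by (rule germ_orderI[OF h H0]) (use s ordH least H1 in auto)
  moreover have "(g \<circ> g) \<approx>\<^sub>0 (h \<circ> h)"
    using germ_eq_iff_fps_eq[OF has_fps_expansion_compose[OF G(1) G(1,2)]
        has_fps_expansion_compose[OF h h H0]] HH by simp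
  moreover have "f \<approx>\<^sub>0 (ginv \<circ> h)"
  proof -
    have "I oo H = F"
      using I F0 G by (simp add: H_def fps_compose_assoc)
    then show ?thesis
      using germ_eq_iff_fps_eq[OF f has_fps_expansion_compose[OF I(1) h H0]] by simp
  qed
  ultimately show ?factors using s gi by blast
next
  assume ?factors
  then obtain g h ginv where gh: "in_H g" "in_H h" "(g \<circ> g) \<approx>\<^sub>0 (h \<circ> h)"
    "germ_inverse g ginv" "f \<approx>\<^sub>0 (ginv \<circ> h)"
    by blast
  obtain G where G: "g has_fps_expansion G" "fps_nth G 0 = 0" "fps_nth G 1 \<noteq> 0"
    using gh by (auto simp: in_G_iff in_H_def)
  obtain H where H: "h has_fps_expansion H" "fps_nth H 0 = 0" "fps_nth H 1 \<noteq> 0"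
    using gh by (auto simp: in_G_iff in_H_def)
  obtain I where I: "ginv has_fps_expansion I" "fps_nth I 0 = 0" "I oo G = fps_X" "G oo I = fps_X"
    using germ_inverse_fps[OF gh(4) G(1,2)] .
  have "in_G f" using assms(2) by (simp add: in_Ap_def in_Gp_def)
  then obtain F where f: "f has_fps_expansion F" by (auto simp: in_G_iff)
  have F: "F = I oo H"
    using gh(5) germ_eq_iff_fps_eq[OF f has_fps_expansion_compose[OF I(1) H(1,2)]] by simp
  have GG: "G oo G = H oo H"
    using gh(3) germ_eq_iff_fps_eq[OF has_fps_expansion_compose[OF G(1) G(1,2)]
        has_fps_expansion_compose[OF H(1) H(1,2)]] by simp
  have I1: "fps_nth I 1 \<noteq> 0"
    using fps_nth_compose_1[OF G(2), of I] I(3) by auto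
  \<comment> \<open>The inverse of f = g^(-1) h is h^(-1) g, and g^2 = h^2 rewrites it as h
    g^(-1).\<close>
  define J where "J = H oo I"
  have J: "(h \<circ> ginv) has_fps_expansion J" "fps_nth J 0 = 0" "fps_nth J 1 \<noteq> 0"
    using has_fps_expansion_compose[OF H(1) I(1,2)] H I I1
    by (simp_all add: J_def fps_nth_compose_1 del: One_nat_def)
  note Z = G(2) H(2) I(2)
  have GF: "G oo F = H"
    unfolding F using Z I(4) by (simp add: fps_compose_assoc)
  have "F oo J = I oo (H oo H) oo I"
    using Z by (simp add: F J_def fps_compose_assoc)
  also have "\<dots> = (I oo G) oo (G oo I)"
    using Z by (simp add: GG[symmetric] fps_compose_assoc)
  finally have FJ: "F oo J = fps_X" by (simp add: I)
  have F0: "fps_nth F 0 = 0" using Z by (simp add: F)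
  have F1: "fps_nth F 1 \<noteq> 0"
    using fps_nth_compose_1[OF J(2), of F] FJ by auto
  \<comment> \<open>A right inverse of F coincides with its two-sided compositional inverse, so J is
    also a left inverse.\<close>
  have "J = fps_inv F oo F oo J"
    using fps_inv[OF F0 F1] J by simp
  also have "\<dots> = fps_inv F"
    using FJ F0 J by (simp add: fps_compose_assoc[symmetric])
  finally have JF: "J oo F = fps_X" using fps_inv[OF F0 F1] by simp
  have fi: "germ_inverse f (h \<circ> ginv)"
    using germ_eq_iff_fps_eq[OF has_fps_expansion_compose[OF f J(1,2)] has_fps_expansion_id] FJ
      germ_eq_iff_fps_eq[OF has_fps_expansion_compose[OF J(1) f F0] has_fps_expansion_id] JF
      in_G_iff J by (auto simp: germ_inverse_def)
  \<comment> \<open>The reversing germ is \<open>ginv\<close>, whose inverse is g: conjugation gives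
    g f g^(-1) = h g^(-1), the inverse of f found above.\<close>
  have "(g \<circ> f \<circ> ginv) has_fps_expansion (G oo F oo I)"
    by (intro has_fps_expansion_compose I f G F0)
  then have "(g \<circ> f \<circ> ginv) \<approx>\<^sub>0 (h \<circ> ginv)"
    using J(1) by (simp add: germ_eq_iff_fps_eq GF J_def)
  moreover have "in_G ginv" "germ_inverse ginv g"
    using gh by (auto simp: germ_inverse_def in_H_def)
  ultimately show "reversible f"
    using \<open>in_G f\<close> fi unfolding reversible_def by blast
qed

end
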